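(* Let $\bar x\in\mathcal{SE}$ and assume that $\vartheta:\mathbb{R}^n\to\mathbb{R}$ is locally Lipschitz around $\bar x$. Suppose that: (i) $f$ is strictly $B$-differentiable at $\bar x$, uniformly on $K$, with family of derivatives $\{D_Bf(\bar x,z):\ z\in K\}$; (ii) the family of mappings $\{D_Bf(\bar x,z):\ z\in K\}$ is equicontinuous at each point of $\mathbb{R}^n$. If the condition $$\mathbf{0}\in\widehat{\partial}\vartheta(\bar x)+\mathrm{int}\left[\left(\bigcap_{z\in K}D_Bf(\bar x,z)^{-1}\big(T(f(\bar x,z);C)\big)\cap T(\bar x;K)\right)^{\ominus}\right]$$ is satisfied, then $\bar x$ is a strict local solution to the problem of minimizing $\vartheta(x)$ subject to $x\in\mathcal{SE}$.
   Context: Setting: $f:\mathbb{R}^n\times\mathbb{R}^n\to\mathbb{R}^m$ is a mapping, $C\subset\mathbb{R}^m$ is a nontrivial closed, convex, pointed cone, and $K\subseteq\mathbb{R}^n$ is a nonempty closed set. The strong vector equilibrium problem asks for $x\in K$ with $f(x,z)\in C$ for all $z\in K$; its solution set is $\mathcal{SE}=\{x\in K:\ f(x,z)\in C\ \ \forall z\in K\}$. "Strict local solution" means: there is $r>0$ such that $\vartheta(x)>\vartheta(\bar x)$ for all $x\in\mathcal{SE}\cap B(\bar x;r)$ with $x\ne\bar x$. Notation: $\mathbf{0}$ is the null vector; $B(x;r)$ is the closed ball of center $x$ and radius $r$; $\mathrm{int}$ denotes interior. For a cone $S\subseteq\mathbb{R}^n$, $S^{\ominus}=\{v\in\mathbb{R}^n:\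 \langle v,s\rangle\le0\ \forall s\in S\}$. For a set $S\subseteq\mathbb{R}^d$ and $\bar s\in S$, the contingent cone to $S$ at $\bar s$ is $T(\bar s;S)=\{v\in\mathbb{R}^d:\ \exists v_k\to v,\ \exists t_k\downarrow0:\ \bar s+t_kv_k\in S\ \forall k\in\mathbb{N}\}$. The Fréchet regular subdifferential of $\vartheta$ at $\bar x$ is $$\widehat{\partial}\vartheta(\bar x)=\left\{v\in\mathbb{R}^n:\ \liminf_{x\to\bar x}\frac{\vartheta(x)-\vartheta(\bar x)-\langle v,x-\bar x\rangle}{\|x-\bar x\|}\ge0\right\}.$$ $\mathcal{PH}(\mathbb{R}^n,\mathbb{R}^m)$ is the space of continuous positively homogeneous mappings from $\mathbb{R}^n$ to $\mathbb{R}^m$. $f$ is strictly $B$-differentiable at $\bar x\in K$, uniformly on $K$, if there is a family $\{D_Bf(\bar x,z)\in\mathcal{PH}(\mathbb{R}^n,\mathbb{R}^m):\ z\in K\}$ such that for every $\epsilon>0$ there is $\delta_\epsilon>0$ with $$\sup_{z\in K}\frac{\|f(x_1,z)-f(x_2,z)-D_Bf(\bar x,z)(x_1-x_2)\|}{\|x_1-x_2\|}<\epsilon\quad\forall x_1,x_2\in B(\bar x;\delta_\epsilon),\ x_1\ne x_2.$$ $D_Bf(\bar x,z)^{-1}(A)$ denotes the preimage $\{v\in\mathbb{R}^n:\ D_Bf(\bar x,z)(v)\in A\}$. *)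

theory Defs
  imports "HOL-Analysis.Analysis"
begin

definition pointed_cone :: "'a::real_vector set \<Rightarrow> bool" where
  "pointed_cone C \<longleftrightarrow> cone C \<and> C \<inter> uminus ` C = {0}"

definition strong_equilibria ::
    "('a \<Rightarrow> 'a \<Rightarrow> 'b) \<Rightarrow> 'b set \<Rightarrow> 'a set \<Rightarrow> 'a set" where
  "strong_equilibria f C K = {x \<in> K. \<forall>z\<in>K. f x z \<in> C}"

definition strict_local_solution ::
    "('a::metric_space \<Rightarrow> real) \<Rightarrow> 'a set \<Rightarrow> 'a \<Rightarrow> bool" where
  "strict_local_solution \<theta> S x \<longleftrightarrow>
     x \<in> S \<and> (\<exists>r>0. \<forall>y \<in> S \<inter> cball x r. y \<noteq> x \<longrightarrow> \<theta> y > \<theta> x)"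

definition locally_lipschitz_around ::
    "('a::metric_space \<Rightarrow> 'b::metric_space) \<Rightarrow> 'a \<Rightarrow> bool" where
  "locally_lipschitz_around g x \<longleftrightarrow> (\<exists>r>0. \<exists>L. L-lipschitz_on (cball x r) g)"

definition polar_cone :: "'a::real_inner set \<Rightarrow> 'a set" where
  "polar_cone S = {v. \<forall>s\<in>S. inner v s \<le> 0}"

definition contingent_cone :: "'a::real_normed_vector \<Rightarrow> 'a set \<Rightarrow> 'a set" where
  "contingent_cone s S =
     {v. \<exists>(w :: nat \<Rightarrow> 'a) (t :: nat \<Rightarrow> real).
           w \<longlonglongrightarrow> v \<and> (\<forall>k. t k > 0) \<and> t \<longlonglongrightarrow> 0 \<and> (\<forall>k. s + t k *\<^sub>R w k \<in> S)}"

text \<open>The limit inferior is taken in the extended reals: it may be infinite.\<close>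
definition frechet_subdifferential :: "('a::real_inner \<Rightarrow> real) \<Rightarrow> 'a \<Rightarrow> 'a set" where
  "frechet_subdifferential \<theta> x =
     {v. Liminf (at x) (\<lambda>y. ereal ((\<theta> y - \<theta> x - inner v (y - x)) / norm (y - x))) \<ge> 0}"

definition continuous_pos_homogeneous ::
    "('a::real_normed_vector \<Rightarrow> 'b::real_normed_vector) set" where
  "continuous_pos_homogeneous =
     {h. continuous_on UNIV h \<and> (\<forall>t>0. \<forall>v. h (t *\<^sub>R v) = t *\<^sub>R h v)}"

text \<open>
  \<open>D\<close> is the family of derivatives; its values outside \<open>K\<close> are irrelevant. The supremum is
  taken in the extended reals, so that it is infinite if the quotients are unbounded over \<open>K\<close>
  (the supremum of an unbounded set of type \<open>real set\<close> is unspecified).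
\<close>
definition has_uniform_strict_B_derivative ::
    "('a::real_normed_vector \<Rightarrow> 'c \<Rightarrow> 'b::real_normed_vector) \<Rightarrow> ('c \<Rightarrow> 'a \<Rightarrow> 'b) \<Rightarrow> 'a \<Rightarrow> 'c set \<Rightarrow> bool" where
  "has_uniform_strict_B_derivative f D x K \<longleftrightarrow>
     (\<forall>z\<in>K. D z \<in> continuous_pos_homogeneous) \<and>
     (\<forall>\<epsilon>>0. \<exists>\<delta>>0. \<forall>x\<^sub>1 \<in> cball x \<delta>. \<forall>x\<^sub>2 \<in> cball x \<delta>. x\<^sub>1 \<noteq> x\<^sub>2 \<longrightarrow>
        (SUP z\<in>K. ereal (norm (f x\<^sub>1 z - f x\<^sub>2 z - D z (x\<^sub>1 - x\<^sub>2)) / norm (x\<^sub>1 - x\<^sub>2))) < ereal \<epsilon>)"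

definition equicontinuous_at ::
    "('a::metric_space \<Rightarrow> 'b::metric_space) set \<Rightarrow> 'a \<Rightarrow> bool" where
  "equicontinuous_at F x \<longleftrightarrow>
     (\<forall>\<epsilon>>0. \<exists>\<delta>>0. \<forall>h\<in>F. \<forall>y. dist y x < \<delta> \<longrightarrow> dist (h y) (h x) < \<epsilon>)"

end

theory Submission
  imports Defs
begin

text \<open>
  If \<open>x\<close> were not a strict local solution, there would be equilibria \<open>y k \<noteq> x\<close> converging to \<open>x\<close>
  with \<open>\<theta> (y k) \<le> \<theta> x\<close>, whose normalised directions converge to a unit vector \<open>u\<close>. Strict
  \<open>B\<close>-differentiability puts \<open>u\<close> into the cone whose polar occurs in the hypothesis. Write
  \<open>0 = v + w\<close> accordingly: since \<open>w\<close> is interior to the polar, \<open>\<langle>w, u\<rangle> < 0\<close>, whereas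
  \<open>v = - w\<close> being a regular subgradient and \<open>\<theta> (y k) \<le> \<theta> x\<close> give \<open>\<langle>v, u\<rangle> \<le> 0\<close>.
\<close>

text \<open>The difference quotients themselves serve as the directions \<open>w k\<close>. This is
  applied below with \<open>t k = norm (y k - x)\<close>, once to the points \<open>y k\<close> in
  \<open>K\<close> and once to the values \<open>f (y k) z\<close> in \<open>C\<close>.\<close>

lemma contingent_coneI_sequence:
  fixes q :: "nat \<Rightarrow> 'a::real_normed_vector"
  assumes "\<And>k. q k \<in> S" and "\<And>k. t k > 0" and "t \<longlonglongrightarrow> 0"
    and "(\<lambda>k. (q k - s) /\<^sub>R t k) \<longlonglongrightarrow> v"
  shows "v \<in> contingent_cone s S"
proof -
  have "s + t k *\<^sub>R ((q k - s) /\<^sub>R t k) = q k" for k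
    using assms(2)[of k] by simp
  with assms show ?thesis
    unfolding contingent_cone_def
    by (intro CollectI exI[of _ "\<lambda>k. (q k - s) /\<^sub>R t k"] exI[of _ t]) auto
qed

text \<open>A ball of radius \<open>e\<close> around \<open>w\<close> lies in the polar. Moving
  \<open>w\<close> by \<open>e\<close> in the direction of \<open>s\<close> itself therefore stays
  there, and this shift raises the inner product with \<open>s\<close> by exactly
  \<open>e * norm s\<close>.\<close>

lemma interior_polar_cone_bound:
  fixes w :: "'a::real_inner"
  assumes "w \<in> interior (polar_cone S)"
  obtains e where "e > 0" and "\<And>s. s \<in> S \<Longrightarrow> inner w s \<le> - e * norm s"
proof -
  obtain e where e: "e > 0" "cball w e \<subseteq> polar_cone S"
    using assms by (meson mem_interior_cball)
  have "inner w s \<le> - e * norm s" if "s \<in> S" for s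
  proof (cases "s = 0")
    case False
    have "w + (e / norm s) *\<^sub>R s \<in> cball w e"
      using False e(1) by (simp add: dist_norm)
    then have "inner (w + (e / norm s) *\<^sub>R s) s \<le> 0"
      using e(2) that unfolding polar_cone_def by blast
    moreover have "inner (w + (e / norm s) *\<^sub>R s) s = inner w s + e * norm s"
      using False by (simp add: inner_add_left dot_square_norm power2_eq_square)
    ultimately show ?thesis by simp
  qed simp
  with e(1) that show thesis by blast
qed

lemma frechet_subdifferential_eventually:
  assumes "v \<in> frechet_subdifferential \<theta> x" and "e > 0"
  shows "\<forall>\<^sub>F y in at x. \<theta> y - \<theta> x - inner v (y - x) > - e * norm (y - x)"
proof -
  have "0 \<le> Liminf (at x) (\<lambda>y. ereal ((\<theta> y - \<theta> x - inner v (y - x)) / norm (y - x)))"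
    using assms(1) by (simp add: frechet_subdifferential_def)
  moreover have "ereal (- e) < 0" using assms(2) by simp
  ultimately have "\<forall>\<^sub>F y in at x. ereal (- e) < ereal ((\<theta> y - \<theta> x - inner v (y - x)) / norm (y - x))"
    unfolding le_Liminf_iff by blast
  \<comment> \<open>Away from \<open>x\<close> the denominator is positive, so the quotient bound
    can be multiplied out.\<close>
  moreover have "\<forall>\<^sub>F y in at x. y \<noteq> x"
    by (simp add: eventually_at_filter)
  ultimately show ?thesis
    by eventually_elim (simp add: pos_less_divide_eq pos_divide_less_eq)
qed

text \<open>By positive homogeneity, dividing \<open>D z (y k - x)\<close> by
  \<open>norm (y k - x)\<close> gives \<open>D z\<close> at the normalised direction, which tends to
  \<open>D z u\<close> by continuity. The strict estimate with second point \<open>x\<close> makes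
  the remaining error vanish.\<close>

lemma uniform_strict_B_derivative_tendsto:
  fixes f :: "'a::real_normed_vector \<Rightarrow> 'c \<Rightarrow> 'b::real_normed_vector"
  assumes B: "has_uniform_strict_B_derivative f D x K" and z: "z \<in> K"
    and y: "y \<longlonglongrightarrow> x" "\<And>k. y k \<noteq> x"
    and u: "(\<lambda>k. (y k - x) /\<^sub>R norm (y k - x)) \<longlonglongrightarrow> u"
  shows "(\<lambda>k. (f (y k) z - f x z) /\<^sub>R norm (y k - x)) \<longlonglongrightarrow> D z u"
proof -
  have D: "continuous_on UNIV (D z)" "\<And>t v. t > 0 \<Longrightarrow> D z (t *\<^sub>R v) = t *\<^sub>R D z v"
    using B z unfolding has_uniform_strict_B_derivative_def continuous_pos_homogeneous_def by auto
  have hom: "D z ((y k - x) /\<^sub>R norm (y k - x)) = D z (y k - x) /\<^sub>R norm (y k - x)" for k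
    using y(2)[of k] by (intro D(2)) simp
  have lim: "(\<lambda>k. D z ((y k - x) /\<^sub>R norm (y k - x))) \<longlonglongrightarrow> D z u"
    using continuous_on_tendsto_compose[OF D(1) u] by simp
  have "(\<lambda>k. (f (y k) z - f x z) /\<^sub>R norm (y k - x) - D z ((y k - x) /\<^sub>R norm (y k - x))) \<longlonglongrightarrow> 0"
  proof (rule tendstoI)
    fix e :: real assume "e > 0"
    then obtain d where d: "d > 0" and
      *: "\<And>x1 x2. x1 \<in> cball x d \<Longrightarrow> x2 \<in> cball x d \<Longrightarrow> x1 \<noteq> x2 \<Longrightarrow>
        (SUP z\<in>K. ereal (norm (f x1 z - f x2 z - D z (x1 - x2)) / norm (x1 - x2))) < ereal e"
      using B unfolding has_uniform_strict_B_derivative_def by meson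
    have "\<forall>\<^sub>F k in sequentially. dist (y k) x < d"
      using y(1) d by (rule tendstoD)
    then show "\<forall>\<^sub>F k in sequentially. dist ((f (y k) z - f x z) /\<^sub>R norm (y k - x)
        - D z ((y k - x) /\<^sub>R norm (y k - x))) 0 < e"
    proof eventually_elim
      case (elim k)
      \<comment> \<open>The quotient for the fixed \<open>z\<close> is dominated by the supremum
        over \<open>K\<close>, to which the uniform estimate applies.\<close>
      have "ereal (norm (f (y k) z - f x z - D z (y k - x)) / norm (y k - x))
          \<le> (SUP z\<in>K. ereal (norm (f (y k) z - f x z - D z (y k - x)) / norm (y k - x)))"
        using z by (rule SUP_upper)
      also have "\<dots> < ereal e"
        using elim d y(2) by (intro *) (auto simp: dist_commute)
      finally show ?case
        unfolding hom by (simp add: scaleR_diff_right [symmetric] divide_inverse mult.commute)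
    qed
  qed
  from tendsto_add[OF this lim] show ?thesis by simp
qed

lemma not_strict_local_solution_sequence:
  fixes x :: "'a::euclidean_space"
  assumes "x \<in> S" and "\<not> strict_local_solution \<theta> S x"
  obtains y u where "\<And>k. y k \<in> S" "\<And>k. y k \<noteq> x" "\<And>k. \<theta> (y k) \<le> \<theta> x" "y \<longlonglongrightarrow> x"
    "(\<lambda>k. (y k - x) /\<^sub>R norm (y k - x)) \<longlonglongrightarrow> u" "norm u = 1"
proof -
  have "\<exists>p. p \<in> S \<and> p \<noteq> x \<and> \<theta> p \<le> \<theta> x \<and> dist x p \<le> inverse (real (Suc k))" for k
  proof -
    have "\<not> (\<forall>y \<in> S \<inter> cball x (inverse (real (Suc k))). y \<noteq> x \<longrightarrow> \<theta> y > \<theta> x)"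
    proof
      assume "\<forall>y \<in> S \<inter> cball x (inverse (real (Suc k))). y \<noteq> x \<longrightarrow> \<theta> y > \<theta> x"
      moreover have "inverse (real (Suc k)) > 0" by simp
      ultimately show False
        using assms unfolding strict_local_solution_def by blast
    qed
    then show ?thesis by (auto simp: not_less)
  qed
  then obtain p where p: "\<And>k. p k \<in> S" "\<And>k. p k \<noteq> x" "\<And>k. \<theta> (p k) \<le> \<theta> x"
      "\<And>k. dist x (p k) \<le> inverse (real (Suc k))"
    using choice[of "\<lambda>k p. p \<in> S \<and> p \<noteq> x \<and> \<theta> p \<le> \<theta> x \<and> dist x p \<le> inverse (real (Suc k))"]
    by blast
  have "(\<lambda>k. dist (p k) x) \<longlonglongrightarrow> 0"
    by (rule tendsto_sandwich[OF _ _ tendsto_const LIMSEQ_inverse_real_of_nat])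
      (use p(4) in \<open>simp_all add: dist_commute\<close>)
  then have lim: "p \<longlonglongrightarrow> x" by (simp only: tendsto_dist_iff [symmetric])
  define d where "d k = (p k - x) /\<^sub>R norm (p k - x)" for k
  have "d k \<in> sphere 0 1" for k
    using p(2)[of k] by (simp add: d_def)
  \<comment> \<open>The unit sphere is compact in finite dimension, so the directions converge along
    a subsequence to a unit vector.\<close>
  then obtain u r where u: "u \<in> sphere 0 1" and r: "strict_mono r" "(d \<circ> r) \<longlonglongrightarrow> u"
    using compact_sphere[of "0 :: 'a" 1] unfolding compact_def by meson
  show thesis
  proof (rule that[of "p \<circ> r" u])
    show "(p \<circ> r) \<longlonglongrightarrow> x" using lim r(1) by (rule LIMSEQ_subseq_LIMSEQ)
    show "(\<lambda>k. ((p \<circ> r) k - x) /\<^sub>R norm ((p \<circ> r) k - x)) \<longlonglongrightarrow> u"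
      using r(2) by (simp add: d_def o_def)
  qed (use p u in auto)
qed


theorem theorem4p7:
  fixes f :: "real^'n \<Rightarrow> real^'n \<Rightarrow> real^'m"
    and D :: "real^'n \<Rightarrow> real^'n \<Rightarrow> real^'m"
    and C :: "(real^'m) set"
    and K :: "(real^'n) set"
    and \<theta> :: "real^'n \<Rightarrow> real"
    and x :: "real^'n"
  assumes "closed C" and "convex C" and "pointed_cone C" and "C \<noteq> {0}"
    and "closed K" and "K \<noteq> {}"
    and "x \<in> strong_equilibria f C K"
    and "locally_lipschitz_around \<theta> x"
    and "has_uniform_strict_B_derivative f D x K"
    and "\<forall>v. equicontinuous_at (D ` K) v"
    and "0 \<in> frechet_subdifferential \<theta> x
           + interior (polar_cone
               ((\<Inter>z\<in>K. D z -` contingent_cone (f x z) C) \<inter> contingent_cone x K))"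
  shows "strict_local_solution \<theta> (strong_equilibria f C K) x"
proof (rule ccontr)
  let ?S = "strong_equilibria f C K"
  let ?W = "(\<Inter>z\<in>K. D z -` contingent_cone (f x z) C) \<inter> contingent_cone x K"
  assume "\<not> strict_local_solution \<theta> ?S x"
  then obtain y u where y: "\<And>k. y k \<in> ?S" "\<And>k. y k \<noteq> x" "\<And>k. \<theta> (y k) \<le> \<theta> x" "y \<longlonglongrightarrow> x"
    and u: "(\<lambda>k. (y k - x) /\<^sub>R norm (y k - x)) \<longlonglongrightarrow> u" "norm u = 1"
    using not_strict_local_solution_sequence[OF assms(7)] by blast
  obtain v w where v: "v \<in> frechet_subdifferential \<theta> x" and w: "w \<in> interior (polar_cone ?W)"
    and vw: "0 = v + w"
    using assms(11) by (rule set_plus_elim)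
  obtain e where e: "e > 0" "\<And>s. s \<in> ?W \<Longrightarrow> inner w s \<le> - e * norm s"
    using interior_polar_cone_bound[OF w] by blast
  have t: "\<And>k. norm (y k - x) > 0" "(\<lambda>k. norm (y k - x)) \<longlonglongrightarrow> 0"
    using y(2,4) by (simp_all add: LIM_zero tendsto_norm_zero)
  have "D z u \<in> contingent_cone (f x z) C" if "z \<in> K" for z
    using y(1) that
    by (intro contingent_coneI_sequence[OF _ t uniform_strict_B_derivative_tendsto
        [OF assms(9) that y(4,2) u(1)]]) (simp add: strong_equilibria_def)
  moreover have "u \<in> contingent_cone x K"
    using y(1) by (intro contingent_coneI_sequence[OF _ t u(1)]) (simp add: strong_equilibria_def)
  ultimately have neg: "inner w u \<le> - e"
    using e(2)[of u] u(2) by simp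
  \<comment> \<open>Since \<open>y k\<close> never equals \<open>x\<close>, the
    punctured-neighbourhood estimate for the subgradient \<open>v\<close> can be read along the
    sequence. Choosing the error \<open>e / 2\<close>, half the margin in \<open>neg\<close>, leaves
    a contradiction after passing to the limit.\<close>
  have "filterlim y (at x) sequentially"
    using y(2,4) by (simp add: filterlim_at)
  then have "\<forall>\<^sub>F k in sequentially.
      \<theta> (y k) - \<theta> x - inner v (y k - x) > - (e / 2) * norm (y k - x)"
    using e(1)
    by (intro eventually_compose_filterlim[OF frechet_subdifferential_eventually[OF v]]) simp_all
  then have "\<forall>\<^sub>F k in sequentially. - (e / 2) \<le> inner w ((y k - x) /\<^sub>R norm (y k - x))"
  proof eventually_elim
    case (elim k)
    \<comment> \<open>As \<open>v = - w\<close> and \<open>\<theta> (y k) - \<theta> x\<close> is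
      nonpositive, the subgradient estimate becomes a lower bound for \<open>w\<close>.\<close>
    have "inner v (y k - x) + inner w (y k - x) = 0"
      unfolding inner_add_left [symmetric] vw [symmetric] by simp
    with elim y(3)[of k] have "- (e / 2) * norm (y k - x) \<le> inner w (y k - x)"
      by linarith
    with t(1)[of k] have "- (e / 2) \<le> inner w (y k - x) / norm (y k - x)"
      by (subst pos_le_divide_eq)
    then show ?case
      by (simp only: inner_scaleR_right divide_inverse_commute)
  qed
  then have "- (e / 2) \<le> inner w u"
    using tendsto_lowerbound[OF tendsto_inner[OF tendsto_const u(1)]] by simp
  with neg e(1) show False by simp
qed

end
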